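(* Every bi-arborescence on $n\ge 2$ vertices is $(2n-2)$-unavoidable.
   Context: A tournament is an orientation of a complete graph. An oriented graph $D$ is $m$-unavoidable if every tournament on $m$ vertices contains a copy of $D$ (as a not necessarily induced subdigraph). An out-arborescence (in-arborescence) is a rooted oriented tree all of whose arcs point away from (towards) its root. A bi-arborescence is a rooted oriented tree that is the union of an in-arborescence and an out-arborescence meeting only in their common root (either of the two may consist of the root alone). *)

theory Defs
  imports "Graph_Theory.Graph_Theory"
begin

text \<open>The locale predicate \<^term>\<open>digraph\<close> demands a finite digraph without loops and parallel arcs.\<close>

definition oriented_graph :: "('a,'b) pre_digraph \<Rightarrow> bool" where
  "oriented_graph G \<longleftrightarrow> digraph G \<and> (\<forall>u v. u \<rightarrow>\<^bsub>G\<^esub> v \<longrightarrow> \<not> v \<rightarrow>\<^bsub>G\<^esub> u)"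

text \<open>The underlying undirected graph of \<open>G\<close> is \<^term>\<open>mk_symmetric G\<close>, where every
  edge is represented by a pair of opposite arcs.\<close>

definition tournament :: "nat \<Rightarrow> ('a,'b) pre_digraph \<Rightarrow> bool" where
  "tournament m T \<longleftrightarrow> oriented_graph T \<and> complete_digraph m (with_proj (mk_symmetric T))"

definition contains_copy :: "('c,'d) pre_digraph \<Rightarrow> ('a,'b) pre_digraph \<Rightarrow> bool" where
  "contains_copy T D \<longleftrightarrow> (\<exists>H. subgraph H T \<and> digraph_iso D H)"

text \<open>The type argument only records in which type the tournaments live, since a definition
  cannot quantify over types; a theorem that leaves it a type variable speaks about all
  tournaments.\<close>

definition unavoidable :: "('c,'d) pre_digraph itself \<Rightarrow> nat \<Rightarrow> ('a,'b) pre_digraph \<Rightarrow> bool" where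
  "unavoidable _ m D \<longleftrightarrow> (\<forall>T :: ('c,'d) pre_digraph. tournament m T \<longrightarrow> contains_copy T D)"

text \<open>The library's \<^term>\<open>tree\<close> is not what is needed here: it only excludes directed cycles,
  so a transitive tournament satisfies it. Cycles of the underlying undirected graph are
  the cycles of \<^term>\<open>mk_symmetric G\<close> of length at least 3; those of length 2 traverse a single
  edge back and forth.\<close>

definition oriented_tree :: "('a,'b) pre_digraph \<Rightarrow> bool" where
  "oriented_tree G \<longleftrightarrow> oriented_graph G \<and> connected G \<and>
     \<not> (\<exists>p. pre_digraph.cycle (with_proj (mk_symmetric G)) p \<and> 3 \<le> length p)"

text \<open>In a tree, an arc points away from \<open>r\<close> if the path of the underlying tree from \<open>r\<close> to
  the head of the arc ends with that arc, and it points towards \<open>r\<close> if the path from its tail to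
  \<open>r\<close> starts with that arc.\<close>

definition points_away :: "('a,'b) pre_digraph \<Rightarrow> 'a \<Rightarrow> 'b \<Rightarrow> bool" where
  "points_away G r e \<longleftrightarrow>
     (\<exists>p. pre_digraph.apath (with_proj (mk_symmetric G)) r (p @ [arc_to_ends G e]) (head G e))"

definition points_towards :: "('a,'b) pre_digraph \<Rightarrow> 'a \<Rightarrow> 'b \<Rightarrow> bool" where
  "points_towards G r e \<longleftrightarrow>
     (\<exists>p. pre_digraph.apath (with_proj (mk_symmetric G)) (tail G e) (arc_to_ends G e # p) r)"

definition out_arborescence :: "('a,'b) pre_digraph \<Rightarrow> 'a \<Rightarrow> bool" where
  "out_arborescence G r \<longleftrightarrow> oriented_tree G \<and> r \<in> verts G \<and> (\<forall>e \<in> arcs G. points_away G r e)"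

definition in_arborescence :: "('a,'b) pre_digraph \<Rightarrow> 'a \<Rightarrow> bool" where
  "in_arborescence G r \<longleftrightarrow> oriented_tree G \<and> r \<in> verts G \<and> (\<forall>e \<in> arcs G. points_towards G r e)"

definition bi_arborescence :: "('a,'b) pre_digraph \<Rightarrow> bool" where
  "bi_arborescence D \<longleftrightarrow> oriented_tree D \<and>
     (\<exists>r A B. subgraph A D \<and> subgraph B D \<and> in_arborescence A r \<and> out_arborescence B r \<and>
        D = Digraph_Component.union A B \<and> verts A \<inter> verts B = {r})"

end

theory Submission
  imports Defs
begin

text \<open>Order the tournament so that the number of forward arcs is maximal. Moving one vertex
  across an interval cannot gain arcs, so each vertex dominates at least half of every interval that
  starts right after it and is dominated by at least half of every interval that ends right before
  it. An out-arborescence with \<open>k \<ge> 2\<close> vertices then embeds into the first \<open>2 k - 2\<close> positions,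
  with its root in front: attach the leaves one by one, two new positions becoming available each
  time, and keep at most half (rounded up) of every final segment occupied, so that the parent of
  the new leaf always has a free out-neighbour to its right. In-arborescences embed symmetrically,
  with the root last, and the two embeddings are glued at the root.\<close>

section \<open>Rooted trees built leaf by leaf from connected graphs in which every edge is a
  bridge\<close>

inductive rooted_tree :: "'a \<Rightarrow> 'a set \<Rightarrow> ('a \<times> 'a) set \<Rightarrow> bool" for r where
  root: "rooted_tree r {r} {}"
| leaf: "rooted_tree r S F \<Longrightarrow> y \<in> S \<Longrightarrow> x \<notin> S \<Longrightarrow> rooted_tree r (insert x S) (insert (y, x) F)"

lemma rooted_tree_root: "rooted_tree r S F \<Longrightarrow> r \<in> S"
  by (induction rule: rooted_tree.induct) auto

lemma rooted_tree_finite: "rooted_tree r S F \<Longrightarrow> finite S"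
  by (induction rule: rooted_tree.induct) auto

lemma rooted_tree_subset: "rooted_tree r S F \<Longrightarrow> F \<subseteq> S \<times> S"
  by (induction rule: rooted_tree.induct) auto

lemma rooted_tree_reach: "rooted_tree r S F \<Longrightarrow> x \<in> S \<Longrightarrow> (r, x) \<in> F\<^sup>*"
proof (induction arbitrary: x rule: rooted_tree.induct)
  case (leaf S F y z)
  have "F\<^sup>* \<subseteq> (insert (y, z) F)\<^sup>*" by (rule rtrancl_mono) auto
  with leaf show ?case by (auto intro: rtrancl_into_rtrancl)
qed auto

lemma rtrancl_sym_pair_removed:
  "(u, v) \<in> (E \<union> E\<inverse> - {(x, y), (y, x)})\<^sup>* \<Longrightarrow> (v, u) \<in> (E \<union> E\<inverse> - {(x, y), (y, x)})\<^sup>*"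
  by (rule symD[OF sym_rtrancl]) (auto intro: symI)

text \<open>\<open>acyc\<close> makes every edge a bridge, and \<open>away\<close> puts
  \<open>r\<close> on the tail side of it. Let \<open>S\<close> be maximal such that its induced
  edges form a rooted tree. If \<open>S\<close> were not all of \<open>V\<close>, connectivity would
  supply an edge between \<open>S\<close> and some \<open>x\<close> outside; the two hypotheses make
  it the only edge between \<open>S\<close> and \<open>x\<close> and direct it towards
  \<open>x\<close>, so \<open>x\<close> could be attached as a leaf.\<close>

lemma rooted_treeI:
  assumes fin: "finite V" and E: "E \<subseteq> V \<times> V" and r: "r \<in> V"
    and conn: "\<And>x. x \<in> V \<Longrightarrow> (r, x) \<in> (E \<union> E\<inverse>)\<^sup>*"
    and acyc: "\<And>u v. (u, v) \<in> E \<Longrightarrow> (u, v) \<notin> (E \<union> E\<inverse> - {(u, v), (v, u)})\<^sup>*"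
    and away: "\<And>u v. (u, v) \<in> E \<Longrightarrow> (r, u) \<in> (E \<union> E\<inverse> - {(u, v), (v, u)})\<^sup>*"
  shows "rooted_tree r V E"
proof -
  define P where "P = (\<lambda>S. S \<subseteq> V \<and> rooted_tree r S (E \<inter> S \<times> S))"
  have noloop: "(u, u) \<notin> E" for u using acyc[of u u] by auto
  have "E \<inter> {r} \<times> {r} = {}" using noloop by auto
  then have "P {r}" using r by (auto simp: P_def intro: rooted_tree.root)
  moreover have "finite {S. P S}" by (rule finite_subset[of _ "Pow V"]) (auto simp: P_def fin)
  ultimately obtain S where S: "P S" and max: "\<And>S'. P S' \<Longrightarrow> S \<subseteq> S' \<Longrightarrow> S' = S"
    using finite_has_maximal[of "{S. P S}"] by (metis empty_iff mem_Collect_eq)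
  have tree: "rooted_tree r S (E \<inter> S \<times> S)" and SV: "S \<subseteq> V" using S by (auto simp: P_def)
  have rS: "r \<in> S" using rooted_tree_root[OF tree] .
  \<comment> \<open>Vertices of \<open>S\<close> are joined inside \<open>S\<close>, so deleting an
    edge at an outside vertex \<open>v\<close> does not separate them.\<close>
  have inS: "(a, b) \<in> (E \<union> E\<inverse> - {(u, v), (v, u)})\<^sup>*"
    if "a \<in> S" "b \<in> S" "v \<notin> S" for a b u v
  proof -
    have "(E \<inter> S \<times> S)\<^sup>* \<subseteq> (E \<union> E\<inverse> - {(u, v), (v, u)})\<^sup>*"
      by (rule rtrancl_mono) (use that in auto)
    then have "(r, a) \<in> (E \<union> E\<inverse> - {(u, v), (v, u)})\<^sup>*" "(r, b) \<in> (E \<union> E\<inverse> - {(u, v), (v, u)})\<^sup>*"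
      using rooted_tree_reach[OF tree] that by auto
    then show ?thesis using rtrancl_sym_pair_removed by (meson rtrancl_trans)
  qed
  have "S = V"
  proof (rule ccontr)
    assume "S \<noteq> V"
    then obtain z where z: "z \<in> V" "z \<notin> S" using SV by auto
    have "\<exists>y x. y \<in> S \<and> x \<notin> S \<and> (y, x) \<in> E \<union> E\<inverse>"
    proof (rule ccontr)
      assume "\<not> ?thesis"
      then have "(E \<union> E\<inverse>) `` S \<subseteq> S" by blast
      then have "(E \<union> E\<inverse>)\<^sup>* `` S = S" by (rule Image_closed_trancl)
      with conn[OF z(1)] rS z(2) show False by blast
    qed
    then obtain y x where yx: "y \<in> S" "x \<notin> S" "(y, x) \<in> E \<union> E\<inverse>" by blast
    \<comment> \<open>Otherwise \<open>r\<close> would reach \<open>x\<close> (by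
      \<open>away\<close>) and \<open>y'\<close> (inside \<open>S\<close>) without crossing the
      bridge between them.\<close>
    have no_in: "(x, y') \<notin> E" if "y' \<in> S" for y'
    proof
      assume xy: "(x, y') \<in> E"
      have "(r, x) \<in> (E \<union> E\<inverse> - {(x, y'), (y', x)})\<^sup>*" using away[OF xy] .
      moreover have "(r, y') \<in> (E \<union> E\<inverse> - {(x, y'), (y', x)})\<^sup>*"
        using inS[of r y' x y'] rS that yx(2) by (simp add: insert_commute)
      ultimately show False using acyc[OF xy] rtrancl_sym_pair_removed by (meson rtrancl_trans)
    qed
    then have E_yx: "(y, x) \<in> E" using yx by auto
    \<comment> \<open>A second edge into \<open>x\<close> would bypass the bridge: go from
      \<open>y\<close> to \<open>y'\<close> inside \<open>S\<close>, then on to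
      \<open>x\<close>.\<close>
    have uniq: "y' = y" if "(y', x) \<in> E" "y' \<in> S" for y'
    proof (rule ccontr)
      assume ne: "y' \<noteq> y"
      have "(y, y') \<in> (E \<union> E\<inverse> - {(y, x), (x, y)})\<^sup>*" using inS[of y y' x y] that yx by simp
      moreover have "(y', x) \<in> E \<union> E\<inverse> - {(y, x), (x, y)}" using that ne yx by auto
      ultimately show False using acyc[OF E_yx] by (meson rtrancl_into_rtrancl)
    qed
    have "E \<inter> insert x S \<times> insert x S = insert (y, x) (E \<inter> S \<times> S)"
    proof (intro equalityI subrelI)
      fix a b assume ab: "(a, b) \<in> E \<inter> insert x S \<times> insert x S"
      then have "a \<in> S" using no_in noloop by blast
      with ab uniq show "(a, b) \<in> insert (y, x) (E \<inter> S \<times> S)" by blast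
    qed (use E_yx yx in blast)
    then have "P (insert x S)"
      using rooted_tree.leaf[OF tree yx(1,2)] SV E E_yx by (auto simp: P_def)
    with max[of "insert x S"] yx(2) show False by auto
  qed
  with tree E show ?thesis by (simp add: Int_absorb2)
qed

section \<open>Arborescences as rooted trees, via walks in the underlying graph\<close>

lemma parcs_mk_symmetric_eq: "parcs (mk_symmetric G) = arcs_ends G \<union> (arcs_ends G)\<inverse>"
  by (auto simp: parcs_mk_symmetric arcs_ends_def arc_to_ends_def)

context pair_wf_digraph
begin

lemma rtrancl_imp_awalk:
  assumes "(u, v) \<in> F\<^sup>*" "F \<subseteq> parcs G" "u \<in> pverts G"
  shows "\<exists>p. awalk u p v \<and> set p \<subseteq> F"
  using assms
proof (induction rule: rtrancl_induct)
  case base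
  then show ?case by (intro exI[of _ "[]"]) (simp add: awalk_Nil_iff)
next
  case (step y z)
  then obtain p where p: "awalk u p y" "set p \<subseteq> F" by blast
  have "awalk y [(y, z)] z" using step arc_implies_awalk[of "(y, z)"] by auto
  with p have "awalk u (p @ [(y, z)]) z" by (blast intro: awalk_appendI)
  with p step show ?case by (intro exI[of _ "p @ [(y, z)]"]) auto
qed

lemma awalk_imp_rtrancl: "awalk u p v \<Longrightarrow> set p \<subseteq> F \<Longrightarrow> (u, v) \<in> F\<^sup>*"
proof (induction p arbitrary: u)
  case (Cons e p)
  then show ?case by (cases e) (auto simp: awalk_Cons_iff intro: converse_rtrancl_into_rtrancl)
qed (simp add: awalk_Nil_iff)

lemma awalk_avoids_vertex:
  assumes "awalk w p w'" "v \<notin> set (awalk_verts w p)"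
  shows "set p \<subseteq> parcs G - {(u, v), (v, u)}"
proof
  fix e assume e: "e \<in> set p"
  have "fst e \<noteq> v" "snd e \<noteq> v"
    using awalk_verts_arc1[OF e, of w] awalk_verts_arc2[OF assms(1) e] assms(2) by auto
  moreover have "e \<in> parcs G" using e assms(1) by auto
  ultimately show "e \<in> parcs G - {(u, v), (v, u)}" by (cases e) auto
qed

text \<open>A walk from \<open>v\<close> to \<open>u\<close> that avoids the edge shortens to a
  simple path, which the arc \<open>(u, v)\<close> closes to a cycle.\<close>

lemma acyclic_imp_bridge:
  assumes acyc: "\<not> (\<exists>p. cycle p \<and> 3 \<le> length p)" and uv: "(u, v) \<in> parcs G" "u \<noteq> v"
  shows "(v, u) \<notin> (parcs G - {(u, v), (v, u)})\<^sup>*"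
proof
  assume "(v, u) \<in> (parcs G - {(u, v), (v, u)})\<^sup>*"
  moreover have "u \<in> pverts G" "v \<in> pverts G" using uv in_arcsD1 in_arcsD2 by auto
  ultimately obtain p where p: "awalk v p u" "set p \<subseteq> parcs G - {(u, v), (v, u)}"
    using rtrancl_imp_awalk by (metis Diff_subset)
  define q where "q = awalk_to_apath p"
  have q: "apath v q u" "set q \<subseteq> parcs G - {(u, v), (v, u)}"
    using apath_awalk_to_apath[OF p(1)] awalk_to_apath_subset[OF p(1)] p(2) by (auto simp: q_def)
  \<comment> \<open>This makes the cycle have length at least 3: a path with a single arc would be
    the deleted \<open>(v, u)\<close>.\<close>
  have "2 \<le> length q"
  proof (rule ccontr)
    assume "\<not> ?thesis"
    then consider "q = []" | e where "q = [e]" by (cases q; cases "tl q") auto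
    then show False
    proof cases
      case 1
      with q(1) uv show False by (simp add: apath_Nil_iff)
    next
      case 2
      with q show False by (cases e) (auto simp: apath_Cons_iff apath_Nil_iff)
    qed
  qed
  moreover have "cycle ((u, v) # q)"
    unfolding cycle_def using q(1) uv by (intro exI[of _ u]) (auto simp: apath_def awalk_Cons_iff)
  ultimately show False using acyc by (metis length_Cons Suc_le_mono numeral_3_eq_3 numeral_2_eq_2)
qed

end

text \<open>\<open>E\<close> lists the edges from parent to child. It is kept abstract so that it
  can be \<open>arcs_ends G\<close> or its converse; only \<open>away\<close> depends on the kind of
  arborescence.\<close>

lemma oriented_tree_rooted_tree:
  assumes tree: "oriented_tree G" and r: "r \<in> verts G"
    and E: "E \<union> E\<inverse> = parcs (mk_symmetric G)"
    and away: "\<And>u v. (u, v) \<in> E \<Longrightarrow> (r, u) \<in> (parcs (mk_symmetric G) - {(u, v), (v, u)})\<^sup>*"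
  shows "rooted_tree r (verts G) E"
proof -
  interpret digraph G using tree by (simp add: oriented_tree_def oriented_graph_def)
  interpret K: pair_digraph "mk_symmetric G" ..
  show ?thesis
  proof (rule rooted_treeI)
    show "finite (verts G)" by simp
    show "E \<subseteq> verts G \<times> verts G" using E K.in_arcsD1 K.in_arcsD2 by auto
    show "r \<in> verts G" by fact
    show "(r, x) \<in> (E \<union> E\<inverse>)\<^sup>*" if x: "x \<in> verts G" for x
    proof -
      have "r \<rightarrow>\<^sup>*\<^bsub>mk_symmetric G\<^esub> x"
        using tree r x by (auto simp: oriented_tree_def connected_def strongly_connected_def)
      then obtain p where "K.awalk r p x" using K.reachable_awalk by blast
      then show ?thesis unfolding E by (rule K.awalk_imp_rtrancl) (use \<open>K.awalk r p x\<close> in blast)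
    qed
    show "(u, v) \<notin> (E \<union> E\<inverse> - {(u, v), (v, u)})\<^sup>*" if uv: "(u, v) \<in> E" for u v
    proof -
      have "(v, u) \<in> parcs (mk_symmetric G)" using E uv by blast
      moreover from this have "v \<noteq> u" using K.pair_no_loops by fastforce
      ultimately have "(u, v) \<notin> (parcs (mk_symmetric G) - {(v, u), (u, v)})\<^sup>*"
        using K.acyclic_imp_bridge tree by (auto simp: oriented_tree_def)
      then show ?thesis unfolding E by (simp add: insert_commute)
    qed
    show "(r, u) \<in> (E \<union> E\<inverse> - {(u, v), (v, u)})\<^sup>*" if "(u, v) \<in> E" for u v
      unfolding E using that by (rule away)
  qed
qed

text \<open>The simple path witnessing \<open>points_away\<close> meets \<open>v\<close> only at its
  end, so the part before the last arc leads from \<open>r\<close> to \<open>u\<close> without the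
  edge.\<close>

lemma out_arborescence_rooted_tree:
  assumes "out_arborescence G r"
  shows "rooted_tree r (verts G) (arcs_ends G)"
proof (rule oriented_tree_rooted_tree)
  show tree: "oriented_tree G" and "r \<in> verts G" using assms by (simp_all add: out_arborescence_def)
  interpret digraph G using tree by (simp add: oriented_tree_def oriented_graph_def)
  interpret K: pair_digraph "mk_symmetric G" ..
  show "arcs_ends G \<union> (arcs_ends G)\<inverse> = parcs (mk_symmetric G)" by (simp add: parcs_mk_symmetric_eq)
  fix u v assume "(u, v) \<in> arcs_ends G"
  then obtain e where e: "e \<in> arcs G" "tail G e = u" "head G e = v" by auto
  then have "points_away G r e" using assms by (simp add: out_arborescence_def)
  then obtain p where "K.apath r (p @ [(u, v)]) v"
    using e by (auto simp: points_away_def arc_to_ends_def)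
  then have p: "K.awalk r p u" "v \<notin> set (K.awalk_verts r p)"
    by (auto simp: K.apath_append_iff K.apath_Cons_iff K.apath_Nil_iff K.awalkI_apath)
  then have "set p \<subseteq> parcs (mk_symmetric G) - {(u, v), (v, u)}"
    by (rule K.awalk_avoids_vertex)
  with p(1) show "(r, u) \<in> (parcs (mk_symmetric G) - {(u, v), (v, u)})\<^sup>*"
    by (rule K.awalk_imp_rtrancl)
qed

text \<open>Here the arcs run from child to parent, hence the converse. The path witnessing
  \<open>points_towards\<close> leads, after its first arc, from \<open>u\<close> to
  \<open>r\<close> and never returns to \<open>v\<close>; it is then traversed backwards.\<close>

lemma in_arborescence_rooted_tree:
  assumes "in_arborescence G r"
  shows "rooted_tree r (verts G) ((arcs_ends G)\<inverse>)"
proof (rule oriented_tree_rooted_tree)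
  show tree: "oriented_tree G" and "r \<in> verts G" using assms by (simp_all add: in_arborescence_def)
  interpret digraph G using tree by (simp add: oriented_tree_def oriented_graph_def)
  interpret K: pair_digraph "mk_symmetric G" ..
  show "(arcs_ends G)\<inverse> \<union> ((arcs_ends G)\<inverse>)\<inverse> = parcs (mk_symmetric G)"
    by (auto simp: parcs_mk_symmetric_eq)
  fix u v assume "(u, v) \<in> (arcs_ends G)\<inverse>"
  then obtain e where e: "e \<in> arcs G" "tail G e = v" "head G e = u" by auto
  then have "points_towards G r e" using assms by (simp add: in_arborescence_def)
  then obtain p where "K.apath v ((v, u) # p) r"
    using e by (auto simp: points_towards_def arc_to_ends_def)
  then have p: "K.awalk u p r" "v \<notin> set (K.awalk_verts u p)"
    by (auto simp: K.apath_Cons_iff K.awalkI_apath)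
  then have "set p \<subseteq> parcs (mk_symmetric G) - {(u, v), (v, u)}"
    by (rule K.awalk_avoids_vertex)
  with p(1) have "(u, r) \<in> (parcs (mk_symmetric G) - {(u, v), (v, u)})\<^sup>*"
    by (rule K.awalk_imp_rtrancl)
  then show "(r, u) \<in> (parcs (mk_symmetric G) - {(u, v), (v, u)})\<^sup>*"
    unfolding parcs_mk_symmetric_eq by (rule rtrancl_sym_pair_removed)
qed

section \<open>Copies from arc-preserving injections of the vertices\<close>

lemma contains_copyI:
  fixes D :: "('a,'b) pre_digraph" and T :: "('c,'d) pre_digraph"
  assumes D: "digraph D" and T: "wf_digraph T"
    and inj: "inj_on \<phi> (verts D)" and sub: "\<phi> ` verts D \<subseteq> verts T"
    and hom: "\<And>x y. (x, y) \<in> arcs_ends D \<Longrightarrow> (\<phi> x, \<phi> y) \<in> arcs_ends T"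
  shows "contains_copy T D"
proof -
  interpret D: digraph D by fact
  have "\<forall>e \<in> arcs D. \<exists>e'. e' \<in> arcs T \<and> tail T e' = \<phi> (tail D e) \<and> head T e' = \<phi> (head D e)"
  proof
    fix e assume "e \<in> arcs D"
    then have "(tail D e, head D e) \<in> arcs_ends D" by (auto simp: arcs_ends_def arc_to_ends_def)
    from hom[OF this] show "\<exists>e'. e' \<in> arcs T \<and> tail T e' = \<phi> (tail D e) \<and> head T e' = \<phi> (head D e)"
      by (auto simp: arcs_ends_def arc_to_ends_def)
  qed
  then obtain \<psi> where \<psi>: "\<And>e. e \<in> arcs D \<Longrightarrow>
      \<psi> e \<in> arcs T \<and> tail T (\<psi> e) = \<phi> (tail D e) \<and> head T (\<psi> e) = \<phi> (head D e)"
    by metis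
  have "inj_on \<psi> (arcs D)"
  proof (rule inj_onI)
    fix e e' assume e: "e \<in> arcs D" "e' \<in> arcs D" "\<psi> e = \<psi> e'"
    then have "tail D e = tail D e'" "head D e = head D e'"
      using \<psi>[of e] \<psi>[of e'] inj D.wellformed by (metis inj_on_eq_iff)+
    then show "e = e'" using D.no_multi_arcs[of e e'] e by (auto simp: arc_to_ends_def)
  qed
  \<comment> \<open>Head and tail maps are those of \<open>T\<close>, so that the image of
    \<open>D\<close> is compatible with \<open>T\<close> and thus a subgraph of it.\<close>
  define f where "f = \<lparr>iso_verts = \<phi>, iso_arcs = \<psi>, iso_head = head T, iso_tail = tail T\<rparr>"
  have iso: "D.digraph_isomorphism f"
    using inj \<open>inj_on \<psi> (arcs D)\<close> \<psi> D.wf_digraph_axioms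
    by (auto simp: D.digraph_isomorphism_def f_def)
  have "wf_digraph (app_iso f D)" using iso by (rule D.wf_digraphI_app_iso)
  then have "subgraph (app_iso f D) T"
    using sub \<psi> T by (auto simp: subgraph_def compatible_def f_def)
  then show ?thesis using iso by (auto simp: contains_copy_def digraph_iso_def)
qed


section \<open>Embedding rooted trees into half-dominating sequences\<close>

definition half_dominating :: "('c \<Rightarrow> 'c \<Rightarrow> bool) \<Rightarrow> (nat \<Rightarrow> 'c) \<Rightarrow> nat \<Rightarrow> bool" where
  "half_dominating R w L \<longleftrightarrow> (\<forall>i j. i \<le> j \<longrightarrow> j < L \<longrightarrow> j - i \<le> 2 * card {k \<in> {i<..j}. R (w i) (w k)})"

text \<open>The bound on \<open>card {x \<in> S. i < f x}\<close> is the invariant of the leaf-by-leaf embedding; with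
  \<open>i = 2 * card S - 3\<close> it also bounds the range of \<open>f\<close>.\<close>

lemma rooted_tree_embedding:
  assumes "rooted_tree r S F"
    and "half_dominating R w (2 * card S - 2)"
  shows "\<exists>f. inj_on f S \<and> f r = 0 \<and> (\<forall>(x, y) \<in> F. R (w (f x)) (w (f y))) \<and>
    (\<forall>i. 2 * card {x \<in> S. i < f x} \<le> 2 * card S - 2 - i)"
  using assms
proof (induction rule: rooted_tree.induct)
  case root
  show ?case by (intro exI[of _ "\<lambda>_. 0"]) auto
next
  case (leaf S F y x)
  have fin: "finite S" using leaf.hyps(1) by (rule rooted_tree_finite)
  define m where "m = 2 * card S - 2"
  have "card S > 0" using leaf.hyps(2) fin by (auto simp: card_gt_0_iff)
  then have m: "2 * card (insert x S) - 2 = m + 2" using leaf.hyps fin by (simp add: m_def)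
  have half: "half_dominating R w (m + 2)" using leaf.prems m by simp
  then have "half_dominating R w m" by (simp add: half_dominating_def)
  then obtain f where f: "inj_on f S" "f r = 0" "\<And>a b. (a, b) \<in> F \<Longrightarrow> R (w (f a)) (w (f b))"
    and occ: "\<And>i. 2 * card {z \<in> S. i < f z} \<le> m - i"
    using leaf.IH[folded m_def] by (auto split: prod.splits)
  define N where "N = {k \<in> {f y<..m + 1}. R (w (f y)) (w k)}"
  \<comment> \<open>The bound is not strict because of the tree consisting of the root alone: there
    \<open>m\<close> is 0 and the root sits at position 0.\<close>
  have fy: "f y \<le> m"
  proof (rule ccontr)
    assume "\<not> f y \<le> m"
    moreover have "{z \<in> S. m < f z} = {}" using occ[of m] fin by simp
    ultimately show False using leaf.hyps by auto
  qed
  \<comment> \<open>Of the \<open>m + 1 - f y\<close> positions right of \<open>f y\<close>, at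
    least half are in \<open>N\<close>, whereas at most \<open>(m - f y) / 2\<close> are occupied.
    Hence some position in \<open>N\<close> is free.\<close>
  have "m + 1 - f y \<le> 2 * card N"
    using half fy unfolding half_dominating_def N_def by (metis Suc_eq_plus1 add_2_eq_Suc' le_SucI lessI)
  moreover have "card (f ` {z \<in> S. f y < f z}) \<le> card {z \<in> S. f y < f z}"
    using fin by (intro card_image_le) simp
  ultimately have "card (f ` {z \<in> S. f y < f z}) < card N" using occ[of "f y"] fy by linarith
  then have "\<not> N \<subseteq> f ` {z \<in> S. f y < f z}" 
    using card_mono[of "f ` {z \<in> S. f y < f z}" N] fin by auto
  then obtain k where k: "k \<in> N" "k \<notin> f ` {z \<in> S. f y < f z}" by blast
  then have k': "f y < k" "k \<le> m + 1" "R (w (f y)) (w k)" "k \<notin> f ` S" by (auto simp: N_def)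
  define g where "g = f(x := k)"
  have gS: "g z = f z" if "z \<in> S" for z using that leaf.hyps by (auto simp: g_def)
  show ?case
  proof (intro exI conjI)
    show "inj_on g (insert x S)" using f(1) k'(4) leaf.hyps gS by (auto simp: inj_on_def g_def)
    show "g r = 0" using f(2) gS rooted_tree_root leaf.hyps by metis
    show "\<forall>(a, b) \<in> insert (y, x) F. R (w (g a)) (w (g b))"
      using f(3) k' gS leaf.hyps rooted_tree_subset[OF leaf.hyps(1)] by (auto simp: g_def)
    show "\<forall>i. 2 * card {z \<in> insert x S. i < g z} \<le> 2 * card (insert x S) - 2 - i"
    proof
      fix i
      have eq: "{z \<in> insert x S. i < g z} = (if i < k then insert x {z \<in> S. i < f z} else {z \<in> S. i < f z})"
        using leaf.hyps by (auto simp: g_def)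
      have "card {z \<in> insert x S. i < g z} = card {z \<in> S. i < f z} + (if i < k then 1 else 0)"
        unfolding eq using fin leaf.hyps by simp
      \<comment> \<open>For \<open>i < k\<close> the left side grows by 2. So does the right side:
        \<open>k\<close> is at most \<open>m + 1\<close>, so \<open>i\<close> is at most
        \<open>m\<close> and \<open>m - i\<close> is not truncated.\<close>
      then show "2 * card {z \<in> insert x S. i < g z} \<le> 2 * card (insert x S) - 2 - i"
        using occ[of i] k'(2) unfolding m by (cases "i < k") auto
    qed
  qed
qed

section \<open>Median orders\<close>

fun forward_arcs :: "('c \<Rightarrow> 'c \<Rightarrow> bool) \<Rightarrow> 'c list \<Rightarrow> nat" where
  "forward_arcs R [] = 0"
| "forward_arcs R (x # xs) = length (filter (R x) xs) + forward_arcs R xs"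

text \<open>Only the pairs formed by \<open>x\<close> and an entry of \<open>bs\<close> change their
  order. The additive form avoids subtraction of naturals.\<close>

lemma forward_arcs_move:
  "forward_arcs R (as @ x # bs @ cs) + length (filter (\<lambda>b. R b x) bs) =
    forward_arcs R (as @ bs @ x # cs) + length (filter (R x) bs)"
proof (induction as)
  case Nil
  show ?case by (induction bs) auto
qed auto

lemma length_filter_segment:
  "length (filter P ys) = card {k \<in> {length xs..<length xs + length ys}. P ((xs @ ys @ zs) ! k)}"
proof -
  have "{k \<in> {length xs..<length xs + length ys}. P ((xs @ ys @ zs) ! k)} =
      (\<lambda>k. length xs + k) ` {k. k < length ys \<and> P (ys ! k)}"
  proof (intro equalityI subsetI)
    fix k assume k: "k \<in> {k \<in> {length xs..<length xs + length ys}. P ((xs @ ys @ zs) ! k)}"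
    then have "k = length xs + (k - length xs)" "k - length xs < length ys" by auto
    with k show "k \<in> (\<lambda>k. length xs + k) ` {k. k < length ys \<and> P (ys ! k)}"
      by (intro image_eqI[of _ _ "k - length xs"]) (auto simp: nth_append)
  qed (auto simp: nth_append)
  then show ?thesis by (simp add: length_filter_conv_card card_image)
qed

lemma length_le_filter_add_filter:
  "(\<And>x. x \<in> set xs \<Longrightarrow> P x \<or> Q x) \<Longrightarrow> length xs \<le> length (filter P xs) + length (filter Q xs)"
  by (induction xs) fastforce+

lemma ex_median_order:
  assumes fin: "finite V" and total: "\<And>x y. x \<in> V \<Longrightarrow> y \<in> V \<Longrightarrow> x \<noteq> y \<Longrightarrow> R x y \<or> R y x"
  obtains xs where "distinct xs" "set xs = V"
    "\<And>i j. i \<le> j \<Longrightarrow> j < length xs \<Longrightarrow> j - i \<le> 2 * card {k \<in> {i<..j}. R (xs ! i) (xs ! k)}"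
    "\<And>i j. i \<le> j \<Longrightarrow> j < length xs \<Longrightarrow> j - i \<le> 2 * card {k \<in> {i..<j}. R (xs ! k) (xs ! j)}"
proof -
  define \<O> where "\<O> = {xs. distinct xs \<and> set xs = V}"
  have "\<O> \<subseteq> {xs. set xs \<subseteq> V \<and> length xs = card V}" by (auto simp: \<O>_def distinct_card)
  then have "finite \<O>" using finite_lists_length_eq[OF fin] by (rule finite_subset)
  moreover have "\<O> \<noteq> {}" using finite_distinct_list[OF fin] by (auto simp: \<O>_def)
  ultimately have "Max (forward_arcs R ` \<O>) \<in> forward_arcs R ` \<O>" by (intro Max_in) auto
  then obtain xs where xs: "xs \<in> \<O>" "forward_arcs R xs = Max (forward_arcs R ` \<O>)" by auto
  have max: "forward_arcs R ys \<le> forward_arcs R xs" if "ys \<in> \<O>" for ys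
    unfolding xs(2) using that \<open>finite \<O>\<close> by (intro Max_ge) auto
  have d: "distinct xs" and V: "set xs = V" using xs(1) by (auto simp: \<O>_def)
  have "j - i \<le> 2 * card {k \<in> {i<..j}. R (xs ! i) (xs ! k)}" if ij: "i \<le> j" "j < length xs" for i j
  proof -
    define as x bs cs where "as = take i xs" and "x = xs ! i" and "bs = take (j - i) (drop (Suc i) xs)"
      and "cs = drop (Suc j) xs"
    have "drop (Suc i) xs = bs @ cs"
      using append_take_drop_id[of "j - i" "drop (Suc i) xs"] ij by (simp add: bs_def cs_def)
    then have eq: "xs = as @ x # bs @ cs"
      using id_take_nth_drop[of i xs] ij by (simp add: as_def x_def)
    have len: "length as = i" "length bs = j - i" using ij by (simp_all add: as_def bs_def)
    \<comment> \<open>The competitor lets \<open>x\<close> jump behind the block at positions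
      \<open>i + 1\<close> to \<open>j\<close>. As it has no more forward arcs, \<open>x\<close>
      dominates at least as many entries of the block as dominate \<open>x\<close>; by
      \<open>total\<close> the two counts together cover the block.\<close>
    have "as @ bs @ x # cs \<in> \<O>" using d V unfolding eq \<O>_def by auto
    from max[OF this] have "length (filter (\<lambda>b. R b x) bs) \<le> length (filter (R x) bs)"
      using forward_arcs_move[of R as x bs cs] unfolding eq by linarith
    moreover have "length bs \<le> length (filter (R x) bs) + length (filter (\<lambda>b. R b x) bs)"
      using d V unfolding eq by (intro length_le_filter_add_filter total) auto
    moreover have "length (filter (R x) bs) = card {k \<in> {i<..j}. R (xs ! i) (xs ! k)}"
    proof -
      have "{length (as @ [x])..<length (as @ [x]) + length bs} = {i<..j}" using len ij by auto
      moreover have "(as @ [x]) @ bs @ cs = xs" using eq by simp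
      ultimately show ?thesis
        using length_filter_segment[of "R x" bs "as @ [x]" cs] by (simp only: x_def)
    qed
    ultimately show ?thesis using len by linarith
  qed
  moreover have "j - i \<le> 2 * card {k \<in> {i..<j}. R (xs ! k) (xs ! j)}" if ij: "i \<le> j" "j < length xs" for i j
  proof -
    define as x bs cs where "as = take i xs" and "x = xs ! j" and "bs = drop i (take j xs)"
      and "cs = drop (Suc j) xs"
    have "take j xs = as @ bs" using ij append_take_drop_id[of i "take j xs"] by (simp add: as_def bs_def min_absorb1)
    then have eq: "xs = as @ bs @ x # cs"
      using id_take_nth_drop[of j xs] ij by (simp add: cs_def x_def)
    have len: "length as = i" "length bs = j - i" using ij by (simp_all add: as_def bs_def)
    \<comment> \<open>The mirror image: \<open>x\<close> jumps from position \<open>j\<close> to the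
      front of the block at positions \<open>i\<close> to \<open>j - 1\<close>.\<close>
    have "as @ x # bs @ cs \<in> \<O>" using d V unfolding eq \<O>_def by auto
    from max[OF this] have "length (filter (R x) bs) \<le> length (filter (\<lambda>b. R b x) bs)"
      using forward_arcs_move[of R as x bs cs] unfolding eq by linarith
    moreover have "length bs \<le> length (filter (R x) bs) + length (filter (\<lambda>b. R b x) bs)"
      using d V unfolding eq by (intro length_le_filter_add_filter total) auto
    moreover have "length (filter (\<lambda>b. R b x) bs) = card {k \<in> {i..<j}. R (xs ! k) (xs ! j)}"
    proof -
      have "{length as..<length as + length bs} = {i..<j}" using len ij by auto
      then show ?thesis
        using length_filter_segment[of "\<lambda>b. R b x" bs as "x # cs"] by (simp only: eq[symmetric]) (simp only: x_def)
    qed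
    ultimately show ?thesis using len by linarith
  qed
  ultimately show thesis using that d V by blast
qed

section \<open>Gluing the two embeddings at the root\<close>

theorem lemma3:
  fixes D :: "('a,'b) pre_digraph" and n :: nat
  assumes "bi_arborescence D" and "card (verts D) = n" and "n \<ge> 2"
  shows "unavoidable TYPE(('c,'d) pre_digraph) (2 * n - 2) D"
  unfolding unavoidable_def
proof (intro allI impI)
  fix T :: "('c,'d) pre_digraph" assume T: "tournament (2 * n - 2) T"
  interpret T: digraph T using T by (simp add: tournament_def oriented_graph_def)
  define R where "R = (\<lambda>x y. (x, y) \<in> arcs_ends T)"
  have card_T: "card (verts T) = 2 * n - 2" using T by (simp add: tournament_def complete_digraph_def)
  have "R x y \<or> R y x" if "x \<in> verts T" "y \<in> verts T" "x \<noteq> y" for x y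
  proof -
    have "(x, y) \<in> parcs (mk_symmetric T)"
      using T that by (auto simp: tournament_def complete_digraph_def)
    then show ?thesis by (auto simp: parcs_mk_symmetric_eq R_def)
  qed
  then obtain xs where xs: "distinct xs" "set xs = verts T"
    and right: "\<And>i j. i \<le> j \<Longrightarrow> j < length xs \<Longrightarrow> j - i \<le> 2 * card {k \<in> {i<..j}. R (xs ! i) (xs ! k)}"
    and left: "\<And>i j. i \<le> j \<Longrightarrow> j < length xs \<Longrightarrow> j - i \<le> 2 * card {k \<in> {i..<j}. R (xs ! k) (xs ! j)}"
    using ex_median_order[of "verts T" R] by auto
  have len: "length xs = 2 * n - 2" using xs card_T distinct_card by metis

  from assms(1) obtain r A B where sub: "subgraph A D" "subgraph B D"
    and A: "in_arborescence A r" and B: "out_arborescence B r"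
    and D: "D = Digraph_Component.union A B" and AB: "verts A \<inter> verts B = {r}"
    unfolding bi_arborescence_def by blast
  have dD: "digraph D" using assms(1) by (simp add: bi_arborescence_def oriented_tree_def oriented_graph_def)
  have treeA: "rooted_tree r (verts A) ((arcs_ends A)\<inverse>)" using A by (rule in_arborescence_rooted_tree)
  have treeB: "rooted_tree r (verts B) (arcs_ends B)" using B by (rule out_arborescence_rooted_tree)
  have fin: "finite (verts A)" "finite (verts B)" using treeA treeB by (auto dest: rooted_tree_finite)
  have vD: "verts D = verts A \<union> verts B" by (simp add: D union_def)
  \<comment> \<open>Being compatible with \<open>D\<close>, both subgraphs share its head and tail
    maps, so every arc keeps its ends in the union.\<close>
  have aD: "arcs_ends D = arcs_ends A \<union> arcs_ends B"
    using sub unfolding subgraph_def compatible_def arcs_ends_def arc_to_ends_def by (auto simp: D union_def)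
  define a b where "a = card (verts A)" and "b = card (verts B)"
  have ab: "a + b = n + 1" using card_Un_Int[OF fin] AB assms(2) by (simp add: vD a_def b_def)
  have "a > 0" "b > 0" using AB fin by (auto simp: a_def b_def card_gt_0_iff)
  \<comment> \<open>The common root goes to position \<open>p\<close> of the median order, the in-arborescence to its left
    and the out-arborescence to its right. For \<open>a = 1\<close>, truncated subtraction gives \<open>p = 0\<close>.\<close>
  define p where "p = 2 * a - 3"
  \<comment> \<open>The last position needed is \<open>2 * n - 4\<close> if \<open>A\<close> and
    \<open>B\<close> both have at least two vertices, and \<open>2 * n - 3\<close> if one of them is
    the root alone, which just fits.\<close>
  have p: "p + (2 * b - 3) < 2 * n - 2" "2 * a - 3 \<le> p" "p < 2 * n - 2"
    using ab \<open>a > 0\<close> \<open>b > 0\<close> assms(3) by (auto simp: p_def)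

  \<comment> \<open>Reading the order leftwards from \<open>p\<close> and reversing \<open>R\<close>
    turns \<open>left\<close> into half-domination, so the same embedding lemma serves both sides.
    Since \<open>j < 2 * a - 2\<close>, the subtraction \<open>p - j\<close> is exact.\<close>
  have "half_dominating (\<lambda>x y. R y x) (\<lambda>k. xs ! (p - k)) (2 * a - 2)"
    unfolding half_dominating_def
  proof (intro allI impI)
    fix i j :: nat assume ij: "i \<le> j" "j < 2 * a - 2"
    then have jp: "j \<le> p" by (simp add: p_def)
    have "{k \<in> {p - j..<p - i}. R (xs ! k) (xs ! (p - i))} =
        (\<lambda>k. p - k) ` {k \<in> {i<..j}. R (xs ! (p - k)) (xs ! (p - i))}"
    proof (intro equalityI subsetI)
      fix k assume k: "k \<in> {k \<in> {p - j..<p - i}. R (xs ! k) (xs ! (p - i))}"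
      with jp ij show "k \<in> (\<lambda>k. p - k) ` {k \<in> {i<..j}. R (xs ! (p - k)) (xs ! (p - i))}"
        by (intro image_eqI[of _ _ "p - k"]) auto
    qed (use jp in auto)
    moreover have "inj_on (\<lambda>k. p - k) {k \<in> {i<..j}. R (xs ! (p - k)) (xs ! (p - i))}"
      using jp by (auto intro!: inj_onI)
    ultimately have "card {k \<in> {p - j..<p - i}. R (xs ! k) (xs ! (p - i))} =
        card {k \<in> {i<..j}. R (xs ! (p - k)) (xs ! (p - i))}" by (simp add: card_image)
    moreover have "p - j \<le> p - i" "p - i < length xs" "p - i - (p - j) = j - i"
      using ij jp p len by linarith+
    ultimately show "j - i \<le> 2 * card {k \<in> {i<..j}. R (xs ! (p - k)) (xs ! (p - i))}"
      using left[of "p - j" "p - i"] by simp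
  qed
  \<comment> \<open>The tree pairs and the relation are both reversed; the reversals cancel, and
    \<open>f\<close> respects the arcs of \<open>A\<close>.\<close>
  from rooted_tree_embedding[OF treeA this[unfolded a_def]]
  obtain f where f: "inj_on f (verts A)" "f r = 0"
    "\<And>x y. (x, y) \<in> arcs_ends A \<Longrightarrow> R (xs ! (p - f x)) (xs ! (p - f y))"
    and f_occ: "\<And>i. 2 * card {x \<in> verts A. i < f x} \<le> 2 * a - 2 - i"
    by (auto simp: a_def split: prod.splits)
  have f_le: "f x \<le> p" if "x \<in> verts A" for x
  proof -
    \<comment> \<open>The bound leaves at most 1 for twice the cardinality, which is therefore
      0.\<close>
    have "card {x \<in> verts A. 2 * a - 3 < f x} = 0" using f_occ[of "2 * a - 3"] by linarith
    then have "{x \<in> verts A. 2 * a - 3 < f x} = {}" using fin by simp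
    then show ?thesis using that p(2) by fastforce
  qed

  have "half_dominating R (\<lambda>k. xs ! (p + k)) (2 * b - 2)"
    unfolding half_dominating_def
  proof (intro allI impI)
    fix i j :: nat assume ij: "i \<le> j" "j < 2 * b - 2"
    have "{k \<in> {p + i<..p + j}. R (xs ! (p + i)) (xs ! k)} =
        (\<lambda>k. p + k) ` {k \<in> {i<..j}. R (xs ! (p + i)) (xs ! (p + k))}"
    proof (intro equalityI subsetI)
      fix k assume k: "k \<in> {k \<in> {p + i<..p + j}. R (xs ! (p + i)) (xs ! k)}"
      then show "k \<in> (\<lambda>k. p + k) ` {k \<in> {i<..j}. R (xs ! (p + i)) (xs ! (p + k))}"
        by (intro image_eqI[of _ _ "k - p"]) auto
    qed auto
    then have "card {k \<in> {p + i<..p + j}. R (xs ! (p + i)) (xs ! k)} =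
        card {k \<in> {i<..j}. R (xs ! (p + i)) (xs ! (p + k))}" by (simp add: card_image)
    with right[of "p + i" "p + j"] show "j - i \<le> 2 * card {k \<in> {i<..j}. R (xs ! (p + i)) (xs ! (p + k))}"
      using ij p len by auto
  qed
  from rooted_tree_embedding[OF treeB this[unfolded b_def]]
  obtain g where g: "inj_on g (verts B)" "g r = 0"
    "\<And>x y. (x, y) \<in> arcs_ends B \<Longrightarrow> R (xs ! (p + g x)) (xs ! (p + g y))"
    and g_occ: "\<And>i. 2 * card {x \<in> verts B. i < g x} \<le> 2 * b - 2 - i"
    by (auto simp: b_def split: prod.splits)
  have g_le: "g x \<le> 2 * b - 3" if "x \<in> verts B" for x
  proof -
    have "card {x \<in> verts B. 2 * b - 3 < g x} = 0" using g_occ[of "2 * b - 3"] by linarith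
    then have "{x \<in> verts B. 2 * b - 3 < g x} = {}" using fin by simp
    then show ?thesis using that by fastforce
  qed

  \<comment> \<open>The two formulas agree at the common vertex \<open>r\<close>, where
    \<open>f\<close> and \<open>g\<close> are 0 and \<open>h\<close> is \<open>p\<close>.\<close>
  define h where "h x = (if x \<in> verts A then p - f x else p + g x)" for x
  have hA: "h x = p - f x" if "x \<in> verts A" for x using that by (simp add: h_def)
  have hB: "h x = p + g x" if "x \<in> verts B" for x
    using that AB f(2) g(2) by (cases "x = r") (auto simp: h_def)
  have h_lt: "h x < length xs" if "x \<in> verts D" for x
    using that g_le p len by (fastforce simp: vD h_def)
  have "r \<in> verts B" using AB by blast
  have g_pos: "g x > 0" if "x \<in> verts B" "x \<notin> verts A" for x
    using that g(1,2) AB \<open>r \<in> verts B\<close> by (metis inj_onD IntE gr0I singletonI)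
  \<comment> \<open>Vertices of \<open>B\<close> other than \<open>r\<close> lie strictly right of
    \<open>p\<close>, so equal positions force the same side and injectivity can be checked on each
    side separately.\<close>
  have h_side: "h x \<le> p \<longleftrightarrow> x \<in> verts A" if "x \<in> verts D" for x
    using that g_pos[of x] by (auto simp: h_def vD)
  have inj_h: "inj_on h (verts D)"
  proof (rule inj_onI)
    fix x y assume xy: "x \<in> verts D" "y \<in> verts D" "h x = h y"
    then have side: "x \<in> verts A \<longleftrightarrow> y \<in> verts A" using h_side by metis
    show "x = y"
    proof (cases "x \<in> verts A")
      case True
      then have "f x = f y" using xy side f_le[of x] f_le[of y] by (simp add: hA)
      with True side show ?thesis using f(1) by (auto dest: inj_onD)
    next
      case False
      then have "g x = g y" "x \<in> verts B" "y \<in> verts B" using xy side by (auto simp: h_def vD)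
      then show ?thesis using g(1) by (auto dest: inj_onD)
    qed
  qed
  show "contains_copy T D"
  proof (rule contains_copyI)
    show "inj_on (\<lambda>x. xs ! h x) (verts D)"
      using inj_h h_lt xs(1) by (auto simp: inj_on_def nth_eq_iff_index_eq)
    show "(\<lambda>x. xs ! h x) ` verts D \<subseteq> verts T" using h_lt xs(2) nth_mem by auto
    fix x y assume "(x, y) \<in> arcs_ends D"
    then consider "(x, y) \<in> arcs_ends A" | "(x, y) \<in> arcs_ends B" by (auto simp: aD)
    then show "(xs ! h x, xs ! h y) \<in> arcs_ends T"
    proof cases
      case 1
      then have "x \<in> verts A" "y \<in> verts A" using rooted_tree_subset[OF treeA] by auto
      with f(3)[OF 1] show ?thesis by (simp add: hA R_def)
    next
      case 2
      then have "x \<in> verts B" "y \<in> verts B" using rooted_tree_subset[OF treeB] by auto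
      with g(3)[OF 2] show ?thesis by (simp add: hB R_def)
    qed
  qed (fact dD, unfold_locales)
qed

end
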